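(* Let $G$ be a graph on vertices $\{1,\dots,n\}$ and $A\in\mathcal{S}(G)$. Suppose $A$ has the SSP and $\lambda$ is an eigenvalue of $A$ with multiplicity $k\ge 1$. Suppose that $\alpha$ is a subset of $\{1,\dots,n\}$ of cardinality $k+1$ such that for every eigenvector $\mathbf{x}$ of $A$ corresponding to $\lambda$, $|\operatorname{supp}(\mathbf{x})\cap\alpha|\ge 2$. Construct $H$ from $G$ by appending a vertex $n+1$ adjacent exactly to the vertices in $\alpha$. Then there exists a matrix $A'\in\mathcal{S}(H)$ such that $A'$ has the SSP, the multiplicity of $\lambda$ has increased from $k$ to $k+1$, and the other eigenvalues and their multiplicities are unchanged from those of $A$.
   Context: All matrices are real and symmetric. For a graph $G$ on vertices $\{1,\dots,n\}$, $\mathcal{S}(G)$ is the set of real symmetric $n\times n$ matrices $A=[a_{ij}]$ such that, for $i\neq j$, $a_{ij}\ne 0$ if and only if $ij$ is an edge of $G$ (diagonal entries are free). $\operatorname{supp}(\mathbf{x})$ is the set of indices of nonzero coordinates of $\mathbf{x}$. Let $\circ$ be the entrywise product and $[A,X]=AX-XA$. $A$ has the Strong Spectral Property (SSP) if the only symmetric $X$ with $A\circ X=O$, $I\circ X=O$, $[A,X]=O$ is $X=O$. *)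

theory Defs
  imports "HOL-Analysis.Analysis"
begin

(* A graph on n vertices is a set of edges over a finite vertex type 'n with CARD('n) = n;
   every element of 'n is a vertex and an edge is a two-element set of vertices. *)

definition simple_graph :: "'v::finite set set \<Rightarrow> bool"
  where "simple_graph E \<longleftrightarrow> (\<forall>e\<in>E. card e = 2)"

(* The vertex type of the enlarged graph is 'v option: Some v is the old vertex v and
   None is the appended one. *)

definition append_vertex :: "'v::finite set set \<Rightarrow> 'v set \<Rightarrow> 'v option set set"
  where "append_vertex E \<alpha> = (\<lambda>e. Some ` e) ` E \<union> {{Some v, None} | v. v \<in> \<alpha>}"

definition symmetric_mat :: "real^'n^'n \<Rightarrow> bool"
  where "symmetric_mat A \<longleftrightarrow> transpose A = A"

definition graph_matrices :: "'n::finite set set \<Rightarrow> (real^'n^'n) set"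
  where "graph_matrices E =
    {A. symmetric_mat A \<and> (\<forall>i j. i \<noteq> j \<longrightarrow> (A $ i $ j \<noteq> 0 \<longleftrightarrow> {i, j} \<in> E))}"

definition entrywise_prod :: "real^'n^'n \<Rightarrow> real^'n^'n \<Rightarrow> real^'n^'n"
  where "entrywise_prod A B = (\<chi> i j. A $ i $ j * B $ i $ j)"

definition commutator :: "real^'n^'n \<Rightarrow> real^'n^'n \<Rightarrow> real^'n^'n"
  where "commutator A X = A ** X - X ** A"

definition SSP :: "real^'n^'n \<Rightarrow> bool"
  where "SSP A \<longleftrightarrow>
    (\<forall>X. symmetric_mat X \<and> entrywise_prod A X = 0 \<and> entrywise_prod (mat 1) X = 0 \<and>
         commutator A X = 0 \<longrightarrow> X = 0)"

definition eigenvector :: "real^'n^'n \<Rightarrow> real \<Rightarrow> real^'n \<Rightarrow> bool"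
  where "eigenvector A \<mu> x \<longleftrightarrow> x \<noteq> 0 \<and> A *v x = \<mu> *\<^sub>R x"

definition eigenspace :: "real^'n^'n \<Rightarrow> real \<Rightarrow> (real^'n) set"
  where "eigenspace A \<mu> = {x. A *v x = \<mu> *\<^sub>R x}"

(* Only used for real symmetric matrices, where geometric and algebraic multiplicities
   agree and all eigenvalues are real; it is 0 iff \<mu> is not an eigenvalue. *)

definition multiplicity_of :: "real^'n^'n \<Rightarrow> real \<Rightarrow> nat"
  where "multiplicity_of A \<mu> = dim (eigenspace A \<mu>)"

definition supp :: "real^'n \<Rightarrow> 'n set"
  where "supp x = {i. x $ i \<noteq> 0}"

end

theory Submission
  imports Defs
begin

text \<open>
  Start from \<open>B = A \<oplus> [\<mu>]\<close>, which already has the required spectrum, and fix \<open>c \<in> \<alpha>\<close>. If \<open>X\<close> is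
  symmetric with zero diagonal, vanishes on the edges of \<open>H\<close> other than \<open>{c, n+1}\<close>, and commutes
  with \<open>B\<close>, then its leading block vanishes by the SSP of \<open>A\<close>, and its last column is a solution of
  \<open>A y = \<mu> y\<close> whose support meets \<open>\<alpha>\<close> at most in \<open>c\<close>, so \<open>X = 0\<close>. This transversality makes the map
  from orthogonal \<open>U\<close> to the entries of \<open>U B U\<^sup>T\<close> off the remaining edges a submersion at the identity,
  so a matrix \<open>C = U B U\<^sup>T\<close> near \<open>B\<close> has all those entries zero except for a small nonzero one at
  \<open>{c, n+1}\<close>. Transversality is an open condition, so \<open>C\<close> has the SSP.

  The other border entries need no control of the perturbation: a vector in the \<open>(k+1)\<close>-dimensional
  \<open>\<mu>\<close>-eigenspace of \<open>C\<close> is determined by its coordinates in \<open>\<alpha> - {i}\<close> and \<open>n+1\<close> (again an open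
  condition), and these can therefore be prescribed. If the border entry at \<open>i\<close> were zero, an
  eigenvector extending the border vector itself, with last coordinate \<open>0\<close>, would force the
  border to vanish.
\<close>

subsection \<open>Transversality\<close>

text \<open>\<open>p\<close> is an orthogonal projection, and \<open>trans\<close> says that no
  nonzero vector of its range is orthogonal to the range of \<open>F'\<close>, so \<open>p\<close>
  composed with \<open>F'\<close> is onto \<open>range p\<close>. Sussmann's open mapping theorem
  then needs only continuity and the derivative at the single point \<open>a\<close>.\<close>

lemma open_mapping_projection:
  fixes F :: "'a::euclidean_space \<Rightarrow> 'b::euclidean_space"
  assumes cont: "continuous_on UNIV F"
    and der: "(F has_derivative F') (at a)"
    and p: "linear p" "\<And>x. p (p x) = p x" "\<And>x y. p x \<bullet> y = x \<bullet> p y"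
    and trans: "\<And>x. p x = x \<Longrightarrow> (\<And>h. x \<bullet> F' h = 0) \<Longrightarrow> x = 0"
    and P: "eventually P (nhds a)"
  shows "\<forall>\<^sub>F y in nhds (F a). \<exists>m. P m \<and> p (F m) = p y"
proof -
  interpret p: linear p by (rule p(1))
  have blp: "bounded_linear p" using p(1) by (simp add: linear_conv_bounded_linear)
  have blF: "bounded_linear F'" using der by (rule has_derivative_bounded_linear)
  interpret F': bounded_linear F' by (rule blF)
  \<comment> \<open>The summand \<open>y - p y\<close> sweeps out the kernel of \<open>p\<close>, so the derivative is onto the whole space.\<close>
  define f where "f = (\<lambda>(m, y). p (F m) + (y - p y))"
  define D where "D = (\<lambda>(m, y). p (F' m) + (y - p y))"
  have linD: "linear D"
    unfolding D_def
    by (auto intro!: linearI simp: F'.add F'.scaleR p.add p.scaleR algebra_simps)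
  have "range D = UNIV"
  proof (rule ccontr)
    assume "range D \<noteq> UNIV"
    moreover have sub: "subspace (range D)"
      using linD by (simp add: linear_subspace_image)
    ultimately have "span (range D) \<subset> span UNIV"
      by (simp add: span_eq_iff[THEN iffD2] psubset_eq)
    from orthogonal_to_subspace_exists_gen[OF this]
    obtain x where x: "x \<noteq> 0" "\<forall>y\<in>span (range D). orthogonal x y" by metis
    have orth: "x \<bullet> D z = 0" for z
      using x(2)[rule_format, of "D z"] by (simp add: orthogonal_def span_base)
    \<comment> \<open>Testing on \<open>(0, y)\<close> puts the orthogonal vector \<open>x\<close>
      in the range of \<open>p\<close>; testing on \<open>(h, 0)\<close> then makes it orthogonal to
      the range of \<open>F'\<close>.\<close>
    have "x \<bullet> (y - p y) = 0" for y
      using orth[of "(0, y)"] by (simp add: D_def F'.zero p.zero)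
    then have "(x - p x) \<bullet> (x - p x) = 0"
      by (metis inner_diff_left inner_diff_right p(3))
    then have px: "p x = x" by simp
    have "x \<bullet> F' h = 0" for h
      using orth[of "(h, 0)"] p(3)[of x "F' h"] px by (simp add: D_def p.zero)
    then show False using trans[OF px] x(1) by blast
  qed
  then obtain g where g: "linear g" "D \<circ> g = id"
    using linear_surjective_right_inverse[OF linD] by blast
  obtain S where S: "open S" "a \<in> S" "\<And>m. m \<in> S \<Longrightarrow> P m"
    using P by (auto simp: eventually_nhds)
  have contp: "continuous_on T p" for T
    using blp by (rule linear_continuous_on)
  have "continuous_on UNIV f"
    unfolding f_def case_prod_unfold
    by (intro continuous_intros continuous_on_compose2[OF contp] continuous_on_compose2[OF cont]) auto
  moreover have "((\<lambda>z. F (fst z)) has_derivative (\<lambda>z. F' (fst z))) (at (a, 0))"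
    by (rule has_derivative_compose[where f = fst and g = F, simplified])
      (auto intro!: derivative_eq_intros der)
  then have "(f has_derivative D) (at (a, 0))"
    unfolding f_def D_def case_prod_unfold
    by (auto intro!: derivative_eq_intros bounded_linear.has_derivative[OF blp])
  moreover have opn: "open (S \<times> (UNIV :: 'b set))" using S(1) by (simp add: open_Times)
  ultimately have "f (a, 0) \<in> interior (f ` (S \<times> UNIV))"
    using sussmann_open_mapping[of UNIV f "(a, 0)" D g "S \<times> UNIV"] g S(2)
    by (simp add: linear_conv_bounded_linear interior_open)
  then have int: "p (F a) \<in> interior (f ` (S \<times> UNIV))" by (simp add: f_def p.zero)
  have "(p \<longlongrightarrow> p (F a)) (nhds (F a))"
    using contp[of UNIV] by (simp add: continuous_on_eq_continuous_within continuous_at tendsto_nhds_iff)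
  then have "\<forall>\<^sub>F y in nhds (F a). p y \<in> interior (f ` (S \<times> UNIV))"
    using int by (rule topological_tendstoD[OF _ open_interior])
  then show ?thesis
  proof eventually_elim
    case (elim y)
    then obtain m z where m: "m \<in> S" "p y = p (F m) + (z - p z)"
      using interior_subset[of "f ` (S \<times> UNIV)"] by (auto simp: f_def)
    \<comment> \<open>Applying \<open>p\<close> annihilates the auxiliary summand
      \<open>z - p z\<close>.\<close>
    have "p y = p (p y)" by (simp add: p(2))
    also have "\<dots> = p (F m)" by (simp add: m(2) p.add p.diff p(2))
    finally show ?case using S(3)[OF m(1)] by auto
  qed
qed

text \<open>On a finite-dimensional subspace an injective linear map is bounded below by
  \<open>e * norm x\<close>, and a perturbation smaller than \<open>e / K\<close> cannot cancel this
  bound.\<close>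

lemma eventually_injective_on:
  fixes g :: "'a::real_normed_vector \<Rightarrow> 'b::euclidean_space \<Rightarrow> 'c::euclidean_space"
  assumes g: "bounded_bilinear g" and S: "subspace S"
    and inj: "\<And>x. x \<in> S \<Longrightarrow> g a x = 0 \<Longrightarrow> x = 0"
  shows "\<forall>\<^sub>F b in nhds a. \<forall>x\<in>S. g b x = 0 \<longrightarrow> x = 0"
proof -
  interpret g: bounded_bilinear g by (rule g)
  obtain e where e: "e > 0" "\<And>x. x \<in> S \<Longrightarrow> e * norm x \<le> norm (g a x)"
    using injective_imp_isometric[OF closed_subspace[OF S] S g.bounded_linear_right[of a]] inj
    by blast
  obtain K where K: "K > 0" "\<And>b x. norm (g b x) \<le> norm b * norm x * K"
    using g.pos_bounded by blast
  have "\<forall>\<^sub>F b in nhds a. dist b a < e / K"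
    using e(1) K(1) by (intro eventually_nhds_metric[THEN iffD2] exI[of _ "e / K"]) simp
  then show ?thesis
  proof eventually_elim
    case (elim b)
    show ?case
    proof (intro ballI impI)
      fix x assume x: "x \<in> S" "g b x = 0"
      have "e * norm x \<le> norm (g a x)" by (rule e(2)[OF x(1)])
      also have "\<dots> = norm (g (b - a) x)" by (simp add: g.diff_left x(2))
      also have "\<dots> \<le> norm (b - a) * norm x * K" by (rule K(2))
      finally have "norm x * (e - norm (b - a) * K) \<le> 0" by (simp add: algebra_simps)
      moreover have "e - norm (b - a) * K > 0"
        using elim K(1) by (simp add: dist_norm field_simps)
      ultimately have "norm x \<le> 0" by (simp add: mult_le_0_iff)
      then show "x = 0" by simp
    qed
  qed
qed

subsection \<open>Matrix algebra\<close>

lemma bounded_bilinear_matrix_mult: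
  "bounded_bilinear ((**) :: real^'n^'m \<Rightarrow> real^'p^'n \<Rightarrow> real^'p^'m)"
  unfolding bilinear_conv_bounded_bilinear[symmetric] bilinear_def
  by (auto intro!: linearI simp: matrix_matrix_mult_def vec_eq_iff algebra_simps sum.distrib
      sum_distrib_left)

lemma bounded_bilinear_matrix_vector_mult:
  "bounded_bilinear ((*v) :: real^'n^'m \<Rightarrow> real^'n \<Rightarrow> real^'m)"
  unfolding bilinear_conv_bounded_bilinear[symmetric] bilinear_def
  by (auto intro!: linearI simp: matrix_vector_mult_def vec_eq_iff algebra_simps sum.distrib
      sum_distrib_left)

lemma bounded_linear_transpose: "bounded_linear (transpose :: real^'n^'m \<Rightarrow> real^'m^'n)"
  unfolding linear_conv_bounded_linear[symmetric]
  by (auto intro!: linearI simp: transpose_def vec_eq_iff)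

lemmas matrix_mult_simps =
  bounded_bilinear.add_left[OF bounded_bilinear_matrix_mult]
  bounded_bilinear.add_right[OF bounded_bilinear_matrix_mult]
  bounded_bilinear.diff_left[OF bounded_bilinear_matrix_mult]
  bounded_bilinear.diff_right[OF bounded_bilinear_matrix_mult]
  bounded_bilinear.minus_left[OF bounded_bilinear_matrix_mult]
  bounded_bilinear.minus_right[OF bounded_bilinear_matrix_mult]
  bounded_bilinear.scaleR_left[OF bounded_bilinear_matrix_mult]
  bounded_bilinear.scaleR_right[OF bounded_bilinear_matrix_mult]

lemma transpose_0: "transpose (0 :: real^'n^'m) = 0"
  by (rule linear_0[OF bounded_linear.linear[OF bounded_linear_transpose]])

lemmas transpose_simps =
  linear_add[OF bounded_linear.linear[OF bounded_linear_transpose]]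
  linear_diff[OF bounded_linear.linear[OF bounded_linear_transpose]]
  linear_neg[OF bounded_linear.linear[OF bounded_linear_transpose]]
  linear_scale[OF bounded_linear.linear[OF bounded_linear_transpose]]
  matrix_transpose_mul

lemma inner_transpose: "transpose X \<bullet> transpose Y = X \<bullet> (Y :: real^'n^'m)"
  unfolding inner_vec_def transpose_def by (simp, rule sum.swap)

lemma inner_matrix_mult_left:
  fixes X :: "real^'p^'m" and A :: "real^'n^'m"
  shows "X \<bullet> (A ** B) = (transpose A ** X) \<bullet> B"
proof -
  have "X \<bullet> (A ** B) = (\<Sum>i\<in>UNIV. \<Sum>j\<in>UNIV. \<Sum>k\<in>UNIV. X$i$j * A$i$k * B$k$j)"
    by (simp add: inner_vec_def matrix_matrix_mult_def sum_distrib_left mult_ac)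
  also have "\<dots> = (\<Sum>i\<in>UNIV. \<Sum>k\<in>UNIV. \<Sum>j\<in>UNIV. X$i$j * A$i$k * B$k$j)"
    by (intro sum.cong sum.swap refl)
  also have "\<dots> = (\<Sum>k\<in>UNIV. \<Sum>i\<in>UNIV. \<Sum>j\<in>UNIV. X$i$j * A$i$k * B$k$j)"
    by (rule sum.swap)
  also have "\<dots> = (\<Sum>k\<in>UNIV. \<Sum>j\<in>UNIV. \<Sum>i\<in>UNIV. X$i$j * A$i$k * B$k$j)"
    by (intro sum.cong sum.swap refl)
  also have "\<dots> = (transpose A ** X) \<bullet> B"
    by (simp add: inner_vec_def matrix_matrix_mult_def transpose_def sum_distrib_left
        sum_distrib_right mult_ac)
  finally show ?thesis .
qed

lemma inner_matrix_mult_right: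
  fixes X :: "real^'p^'m" and A :: "real^'n^'m"
  shows "X \<bullet> (A ** B) = (X ** transpose B) \<bullet> A"
proof -
  have "X \<bullet> (A ** B) = transpose X \<bullet> (transpose B ** transpose A)"
    by (simp add: inner_transpose matrix_transpose_mul[symmetric])
  also have "\<dots> = transpose (X ** transpose B) \<bullet> transpose A"
    by (simp add: inner_matrix_mult_left matrix_transpose_mul)
  finally show ?thesis by (simp add: inner_transpose)
qed

text \<open>Self-adjointness of \<open>commutator B\<close> turns orthogonality to the tangent
  directions \<open>[B, K]\<close> into a statement about \<open>[B, X]\<close>.\<close>

lemma inner_commutator:
  fixes B :: "real^'n^'n"
  assumes "symmetric_mat B"
  shows "X \<bullet> commutator B K = commutator B X \<bullet> K"
  using assms
  by (simp add: commutator_def symmetric_mat_def inner_diff_right inner_diff_left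
      inner_matrix_mult_left[of X B K] inner_matrix_mult_right[of X K B])

lemma bounded_bilinear_commutator:
  "bounded_bilinear (commutator :: real^'n^'n \<Rightarrow> _)"
  unfolding bilinear_conv_bounded_bilinear[symmetric] bilinear_def
  by (auto intro!: linearI simp: commutator_def matrix_mult_simps algebra_simps)

subsection \<open>The Cayley transform\<close>

text \<open>This is \<open>(I - K) (I + K)^{-1}\<close> written with a single inverse; on skew
  matrices it is a rational parametrization by orthogonal matrices.\<close>

definition cayley :: "real^'n^'n \<Rightarrow> real^'n^'n"
  where "cayley K = 2 *\<^sub>R matrix_inv (mat 1 + K) - mat 1"

text \<open>Skewness gives \<open>x \<bullet> (K *v x) = 0\<close>, so pairing
  \<open>(I + K) x\<close> with \<open>x\<close> returns the squared norm of \<open>x\<close> and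
  the kernel is trivial.\<close>

lemma skew_plus_identity_inverse:
  fixes K :: "real^'n^'n"
  assumes "transpose K = - K"
  shows "(mat 1 + K) ** matrix_inv (mat 1 + K) = mat 1"
    and "matrix_inv (mat 1 + K) ** (mat 1 + K) = mat 1"
proof -
  have "x = 0" if "(mat 1 + K) *v x = 0" for x
  proof -
    have "x \<bullet> (K *v x) = (transpose K *v x) \<bullet> x"
      by (simp add: dot_lmul_matrix)
    also have "\<dots> = - (x \<bullet> (K *v x))"
      using assms by (simp del: transpose_matrix_vector
          add: bounded_bilinear.minus_left[OF bounded_bilinear_matrix_vector_mult] inner_commute)
    finally have "x \<bullet> (K *v x) = 0" by simp
    moreover have "x \<bullet> ((mat 1 + K) *v x) = x \<bullet> x + x \<bullet> (K *v x)"
      by (simp add: matrix_vector_mult_add_rdistrib inner_add_right)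
    ultimately show "x = 0" using that by simp
  qed
  then obtain T where "T ** (mat 1 + K) = mat 1"
    using matrix_left_invertible_ker[of "mat 1 + K"] by blast
  then have "\<exists>T. (mat 1 + K) ** T = mat 1 \<and> T ** (mat 1 + K) = mat 1"
    using matrix_left_right_inverse by blast
  then have "(mat 1 + K) ** matrix_inv (mat 1 + K) = mat 1 \<and>
      matrix_inv (mat 1 + K) ** (mat 1 + K) = mat 1"
    unfolding matrix_inv_def by (rule someI_ex)
  then show "(mat 1 + K) ** matrix_inv (mat 1 + K) = mat 1"
    "matrix_inv (mat 1 + K) ** (mat 1 + K) = mat 1"
    by auto
qed

text \<open>Pairing \<open>(I + K) T = I\<close> with \<open>T\<close> kills the skew term, and
  Cauchy-Schwarz leaves a bound independent of \<open>K\<close>.\<close>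

lemma norm_matrix_inv_skew_plus_identity:
  fixes K :: "real^'n^'n"
  assumes "transpose K = - K"
  shows "norm (matrix_inv (mat 1 + K)) \<le> norm (mat 1 :: real^'n^'n)"
proof -
  define T where "T = matrix_inv (mat 1 + K)"
  have "T \<bullet> (K ** T) = (transpose K ** T) \<bullet> T" by (rule inner_matrix_mult_left)
  also have "\<dots> = - (T \<bullet> (K ** T))"
    using assms by (simp add: matrix_mult_simps inner_commute)
  finally have "T \<bullet> (K ** T) = 0" by simp
  moreover have "T \<bullet> ((mat 1 + K) ** T) = T \<bullet> T + T \<bullet> (K ** T)"
    by (simp add: matrix_mult_simps inner_add_right)
  ultimately have "T \<bullet> T = T \<bullet> mat 1"
    using skew_plus_identity_inverse(1)[OF assms] by (simp add: T_def)
  then have "norm T * norm T \<le> norm T * norm (mat 1 :: real^'n^'n)"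
    using norm_cauchy_schwarz[of T "mat 1"] by (simp add: power2_norm_eq_inner[symmetric] power2_eq_square)
  then have "norm T \<le> norm (mat 1 :: real^'n^'n)"
    by (cases "norm T = 0") (auto simp: mult_le_cancel_left)
  then show ?thesis by (simp add: T_def)
qed

lemma cayley_0 [simp]: "cayley (0 :: real^'n^'n) = mat 1"
proof -
  have "matrix_inv (mat 1) = (mat 1 :: real^'n^'n)"
    using skew_plus_identity_inverse(1)[of 0] by (simp add: transpose_0)
  then show ?thesis by (simp only: cayley_def add_0_right scaleR_2 add_diff_cancel_right')
qed

lemma orthogonal_matrix_cayley:
  fixes K :: "real^'n^'n"
  assumes "transpose K = - K"
  shows "orthogonal_matrix (cayley K)"
proof -
  define T where "T = matrix_inv (mat 1 + K)"
  have 1: "T + K ** T = mat 1"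
    using skew_plus_identity_inverse(1)[OF assms] by (simp add: T_def matrix_mult_simps)
  have 2: "transpose T - transpose T ** K = mat 1"
    using arg_cong[OF 1, of transpose] assms by (simp add: transpose_simps matrix_mult_simps)
  \<comment> \<open>Both brackets equal the identity, and the terms containing \<open>K\<close>
    cancel on expansion. The result is equivalent to
    \<open>(2 T^T - I) (2 T - I) = I\<close>.\<close>
  have "transpose T + T = transpose T ** (T + K ** T) + (transpose T - transpose T ** K) ** T"
    by (simp only: 1 2 matrix_mul_lid matrix_mul_rid)
  also have "\<dots> = 2 *\<^sub>R (transpose T ** T)"
    by (simp add: matrix_mult_simps matrix_mul_assoc scaleR_2)
  finally have "transpose T + T = 2 *\<^sub>R (transpose T ** T)" .
  then have 3: "2 *\<^sub>R (2 *\<^sub>R (transpose T ** T)) = 2 *\<^sub>R transpose T + 2 *\<^sub>R T"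
    by (simp flip: scaleR_right_distrib)
  have "transpose (cayley K) ** cayley K =
      2 *\<^sub>R (2 *\<^sub>R (transpose T ** T)) - 2 *\<^sub>R transpose T - 2 *\<^sub>R T + mat 1"
    unfolding cayley_def T_def[symmetric]
    by (simp add: transpose_simps matrix_mult_simps scaleR_diff_right)
  then have "transpose (cayley K) ** cayley K = mat 1" by (simp only: 3) simp
  then show ?thesis by (simp add: orthogonal_matrix)
qed

text \<open>The resolvent identity: \<open>L - K\<close> is \<open>(I + L) - (I + K)\<close>, and
  each summand cancels against an adjacent inverse.\<close>

lemma matrix_inv_skew_diff:
  fixes K L :: "real^'n^'n"
  assumes "transpose K = - K" "transpose L = - L"
  shows "matrix_inv (mat 1 + K) - matrix_inv (mat 1 + L) =
    matrix_inv (mat 1 + K) ** (L - K) ** matrix_inv (mat 1 + L)"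
proof -
  let ?S = "matrix_inv (mat 1 + K)" and ?T = "matrix_inv (mat 1 + L)"
  have "?S ** (L - K) ** ?T = ?S ** ((mat 1 + L) - (mat 1 + K)) ** ?T" by simp
  also have "\<dots> = ?S ** ((mat 1 + L) ** ?T) - (?S ** (mat 1 + K)) ** ?T"
    by (simp only: matrix_mult_simps(3,4) matrix_mul_assoc)
  also have "\<dots> = ?S - ?T"
    by (simp only: skew_plus_identity_inverse assms matrix_mul_lid matrix_mul_rid)
  finally show ?thesis by simp
qed

lemma cayley_diff:
  fixes K L :: "real^'n^'n"
  assumes "transpose K = - K" "transpose L = - L"
  shows "cayley K - cayley L =
    2 *\<^sub>R (matrix_inv (mat 1 + K) ** (L - K) ** matrix_inv (mat 1 + L))"
  by (simp add: cayley_def matrix_inv_skew_diff[OF assms, symmetric] scaleR_diff_right)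

lemma continuous_on_cayley:
  "continuous_on {K :: real^'n^'n. transpose K = - K} cayley"
proof -
  define c where "c = norm (mat 1 :: real^'n^'n)"
  obtain C where C: "C > 0" "\<And>(A :: real^'n^'n) (B :: real^'n^'n). norm (A ** B) \<le> norm A * norm B * C"
    using bounded_bilinear.pos_bounded[OF bounded_bilinear_matrix_mult] by blast
  \<comment> \<open>The 2 comes from the definition of \<open>cayley\<close>, each \<open>c\<close>
    bounds an inverse, and each \<open>C\<close> pays for a matrix product.\<close>
  have "(2 * c * c * C * C)-lipschitz_on {K :: real^'n^'n. transpose K = - K} cayley"
  proof (rule lipschitz_onI)
    fix K L :: "real^'n^'n"
    assume KL: "K \<in> {K. transpose K = - K}" "L \<in> {K. transpose K = - K}"
    let ?S = "matrix_inv (mat 1 + K)" and ?T = "matrix_inv (mat 1 + L)"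
    have "norm (?S ** (L - K) ** ?T) \<le> norm (?S ** (L - K)) * norm ?T * C" by (rule C(2))
    also have "\<dots> \<le> (norm ?S * norm (L - K) * C) * norm ?T * C"
      using C by (intro mult_right_mono) auto
    also have "\<dots> \<le> (c * norm (L - K) * C) * c * C"
      using C(1) KL by (intro mult_mono) (auto simp: c_def norm_matrix_inv_skew_plus_identity)
    finally show "dist (cayley K) (cayley L) \<le> 2 * c * c * C * C * dist K L"
      using KL by (simp add: dist_norm cayley_diff norm_minus_commute mult_ac)
  qed (use C(1) in \<open>simp add: c_def\<close>)
  then show ?thesis by (rule lipschitz_on_continuous_on)
qed

text \<open>The remainder is exactly \<open>2 T K K\<close> with \<open>T\<close> the inverse of
  \<open>I + K\<close>; \<open>T\<close> is uniformly bounded on skew matrices, so this is quadratic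
  in \<open>K\<close>.\<close>

lemma cayley_has_derivative:
  "(cayley has_derivative (\<lambda>K. - 2 *\<^sub>R K)) (at 0 within {K :: real^'n^'n. transpose K = - K})"
proof -
  define c where "c = norm (mat 1 :: real^'n^'n)"
  obtain C where C: "C > 0" "\<And>(A :: real^'n^'n) (B :: real^'n^'n). norm (A ** B) \<le> norm A * norm B * C"
    using bounded_bilinear.pos_bounded[OF bounded_bilinear_matrix_mult] by blast
  have zero: "transpose (0 :: real^'n^'n) = - 0" by (simp add: transpose_0)
  show ?thesis
  \<comment> \<open>The estimate holds for every nonzero skew \<open>K\<close>, so the radius 1 is
    arbitrary.\<close>
  proof (rule has_derivativeI_sandwich[where e = 1])
    fix K :: "real^'n^'n"
    assume K: "K \<in> {K. transpose K = - K}" "K \<noteq> 0"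
    let ?T = "matrix_inv (mat 1 + K)"
    have id: "matrix_inv (mat 1 + 0) = (mat 1 :: real^'n^'n)"
      using skew_plus_identity_inverse(1)[OF zero] by simp
    have "?T - mat 1 = - (?T ** K)"
      using matrix_inv_skew_diff[OF _ zero, of K] K(1) by (simp add: id[simplified] matrix_mult_simps)
    moreover have "cayley K - cayley 0 - (- 2 *\<^sub>R (K - 0)) = 2 *\<^sub>R (K - ?T ** K)"
      using cayley_diff[OF _ zero, of K] K(1)
      by (simp add: id[simplified] matrix_mult_simps algebra_simps del: cayley_0)
    moreover have "(mat 1 - ?T) ** K = K - ?T ** K" by (simp add: matrix_mult_simps)
    ultimately have eq: "cayley K - cayley 0 - (- 2 *\<^sub>R (K - 0)) = 2 *\<^sub>R (?T ** K ** K)"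
      by (metis minus_diff_eq minus_minus)
    have "norm (?T ** K ** K) \<le> norm (?T ** K) * norm K * C" by (rule C(2))
    also have "\<dots> \<le> (norm ?T * norm K * C) * norm K * C"
      using C by (intro mult_right_mono) auto
    also have "\<dots> \<le> (c * norm K * C) * norm K * C"
      using C(1) K(1) by (intro mult_mono) (auto simp: c_def norm_matrix_inv_skew_plus_identity)
    finally have "norm (?T ** K ** K) \<le> c * C * C * norm K * norm K" by (simp add: mult_ac)
    then show "norm (cayley K - cayley 0 - (- 2 *\<^sub>R (K - 0))) / norm (K - 0) \<le> 2 * c * C * C * norm K"
      unfolding eq using K(2) by (simp add: field_simps)
  next
    have "((\<lambda>K :: real^'n^'n. 2 * c * C * C * norm K) \<longlongrightarrow> 2 * c * C * C * norm (0 :: real^'n^'n))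
        (at 0 within {K. transpose K = - K})"
      by (intro tendsto_intros)
    then show "((\<lambda>K :: real^'n^'n. 2 * c * C * C * norm K) \<longlongrightarrow> 0)
        (at 0 within {K. transpose K = - K})" by simp
  qed (auto intro!: bounded_linear_scaleR_right bounded_linear_minus)
qed

section \<open>Isospectral perturbation with prescribed entries\<close>

lemma symmetric_matD: "symmetric_mat X \<Longrightarrow> X $ i $ j = X $ j $ i"
  unfolding symmetric_mat_def transpose_def vec_eq_iff by simp

text \<open>The tangent space at \<open>B\<close> of the orbit \<open>U B U^T\<close> consists of
  the \<open>[B, K]\<close> with \<open>K\<close> skew. By \<open>trans\<close>, no nonzero
  symmetric matrix supported on \<open>Z\<close> is orthogonal to it, so the entries on
  \<open>Z\<close> can be moved freely; the others are controlled only through the open condition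
  \<open>P\<close>.\<close>

lemma isospectral_perturbation:
  fixes B :: "real^'n^'n" and Z :: "'n \<Rightarrow> 'n \<Rightarrow> bool"
  assumes B: "symmetric_mat B" and Z: "symp Z"
    and trans: "\<And>X. symmetric_mat X \<Longrightarrow> (\<And>i j. \<not> Z i j \<Longrightarrow> X $ i $ j = 0) \<Longrightarrow>
      commutator B X = 0 \<Longrightarrow> X = 0"
    and P: "eventually P (nhds B)"
  shows "\<forall>\<^sub>F Y in nhds B. symmetric_mat Y \<longrightarrow>
    (\<exists>U. orthogonal_matrix U \<and> P (U ** B ** transpose U) \<and>
      (\<forall>i j. Z i j \<longrightarrow> (U ** B ** transpose U) $ i $ j = Y $ i $ j))"
proof -
  \<comment> \<open>Skewing an arbitrary matrix makes the parameter domain a full Euclidean space,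
    as \<open>open_mapping_projection\<close> requires.\<close>
  define skew where "skew = (\<lambda>M :: real^'n^'n. M - transpose M)"
  have skew: "transpose (skew M) = - skew M" for M
    by (simp add: skew_def transpose_simps)
  define F where "F = (\<lambda>M. cayley (skew M) ** B ** transpose (cayley (skew M)))"
  \<comment> \<open>Since \<open>Z\<close> is symmetric, this is the orthogonal projection onto the
    symmetric matrices supported on \<open>Z\<close>.\<close>
  define p where "p = (\<lambda>X :: real^'n^'n. \<chi> i j. if Z i j then (X $ i $ j + X $ j $ i) / 2 else 0)"
  have skew0: "skew 0 = 0" by (simp add: skew_def transpose_0)
  have F0: "F 0 = B" by (simp add: F_def skew_def transpose_0)
  have bl_skew: "bounded_linear skew"
    unfolding skew_def by (intro bounded_linear_sub bounded_linear_ident bounded_linear_transpose)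
  have cont: "continuous_on UNIV (\<lambda>M. cayley (skew M))"
    by (rule continuous_on_compose2[OF continuous_on_cayley linear_continuous_on[OF bl_skew]])
      (auto simp: skew)
  note cont_intros = bounded_bilinear.continuous_on[OF bounded_bilinear_matrix_mult]
    bounded_linear.continuous_on[OF bounded_linear_transpose]
  have contF: "continuous_on UNIV F"
    unfolding F_def by (intro cont_intros cont continuous_on_const)
  have c: "(cayley has_derivative (\<lambda>K. - 2 *\<^sub>R K)) (at (skew 0) within range skew)"
    unfolding skew0 by (rule has_derivative_subset[OF cayley_has_derivative]) (auto simp: skew)
  have der: "((\<lambda>M. cayley (skew M)) has_derivative (\<lambda>M. - 2 *\<^sub>R skew M)) (at 0)"
    by (rule has_derivative_in_compose[OF bounded_linear_imp_has_derivative[OF bl_skew] c])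
  \<comment> \<open>With \<open>K = skew M\<close>, the two product-rule terms are
    \<open>-2 K B\<close> and \<open>2 B K\<close>, the sign of the second coming from the
    transpose.\<close>
  have F': "(F has_derivative (\<lambda>M. 2 *\<^sub>R commutator B (skew M))) (at 0)"
    unfolding F_def
    by (rule has_derivative_eq_rhs,
        rule bounded_bilinear.FDERIV[OF bounded_bilinear_matrix_mult
          bounded_bilinear.FDERIV[OF bounded_bilinear_matrix_mult der has_derivative_const]
          bounded_linear.has_derivative[OF bounded_linear_transpose der]])
      (simp add: skew0 commutator_def transpose_simps matrix_mult_simps skew scaleR_diff_right)
  have symp: "Z i j = Z j i" for i j using Z by (auto dest: sympD)
  have linp: "linear p"
    by (auto intro!: linearI simp: p_def vec_eq_iff algebra_simps add_divide_distrib)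
  have idem: "p (p X) = p X" for X
    by (simp add: p_def vec_eq_iff symp add.commute)
  have adj: "p X \<bullet> Y = X \<bullet> p Y" for X Y
  proof -
    define z where "z = (\<lambda>i j. if Z i j then 1 / 2 else 0 :: real)"
    have z: "z i j = z j i" for i j by (simp add: z_def symp)
    have p: "p X $ i $ j = z i j * X $ i $ j + z i j * X $ j $ i" for X i j
      by (simp add: p_def z_def)
    have "(\<Sum>i\<in>UNIV. \<Sum>j\<in>UNIV. z i j * X $ j $ i * Y $ i $ j) =
        (\<Sum>i\<in>UNIV. \<Sum>j\<in>UNIV. z i j * X $ i $ j * Y $ j $ i)"
      by (subst sum.swap) (simp add: z)
    then show ?thesis
      by (simp add: inner_vec_def p distrib_left distrib_right sum.distrib mult_ac)
  qed
  have "X = 0" if X: "p X = X" "\<And>M. X \<bullet> 2 *\<^sub>R commutator B (skew M) = 0" for X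
  proof (rule trans)
    have Xij: "X $ i $ j = (if Z i j then (X $ i $ j + X $ j $ i) / 2 else 0)" for i j
      using arg_cong[OF X(1), of "\<lambda>X. X $ i $ j"] by (simp add: p_def)
    show "X $ i $ j = 0" if "\<not> Z i j" for i j using Xij[of i j] that by simp
    have "X $ i $ j = X $ j $ i" for i j
      using Xij[of i j] Xij[of j i] symp[of i j] by (cases "Z i j") auto
    then show "symmetric_mat X" by (simp add: symmetric_mat_def transpose_def vec_eq_iff)
    \<comment> \<open>\<open>[B, X]\<close> is itself skew, hence an admissible direction; testing
      on it and using self-adjointness gives \<open>[B, X] \<bullet> [B, X] = 0\<close>.\<close>
    then have "transpose (commutator B X) = - commutator B X"
      using B by (simp add: commutator_def symmetric_mat_def transpose_simps)
    then have "skew (commutator B X) = 2 *\<^sub>R commutator B X"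
      by (simp add: skew_def scaleR_2)
    then show "commutator B X = 0"
      using X(2)[of "commutator B X"] inner_commutator[OF B, of X "2 *\<^sub>R commutator B X"] by simp
  qed
  moreover have "\<forall>\<^sub>F M in nhds 0. P (F M)"
  proof -
    have "(F \<longlongrightarrow> B) (nhds 0)"
      using contF F0 by (metis UNIV_I continuous_on_eq_continuous_at continuous_at open_UNIV tendsto_nhds_iff)
    then show ?thesis by (rule eventually_compose_filterlim[OF P])
  qed
  ultimately have "\<forall>\<^sub>F Y in nhds (F 0). \<exists>M. P (F M) \<and> p (F M) = p Y"
    using open_mapping_projection[OF contF F' linp idem adj] by blast
  then show ?thesis unfolding F0
  proof eventually_elim
    case (elim Y)
    then obtain M where M: "P (F M)" "p (F M) = p Y" by blast
    let ?U = "cayley (skew M)"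
    have sym: "symmetric_mat (F M)"
      using B by (simp add: F_def symmetric_mat_def matrix_transpose_mul matrix_mul_assoc)
    have "F M $ i $ j = Y $ i $ j" if "symmetric_mat Y" "Z i j" for i j
      using arg_cong[OF M(2), of "\<lambda>X. X $ i $ j"] that symmetric_matD[OF sym, of i j] symmetric_matD[OF that(1), of i j]
      by (simp add: p_def)
    then show ?case
      using M(1) orthogonal_matrix_cayley[OF skew[of M]] unfolding F_def by blast
  qed
qed

subsection \<open>Bordering by an isolated vertex\<close>

definition augment :: "real^'n^'n \<Rightarrow> real \<Rightarrow> real^'n option^'n option"
  where "augment A \<mu> = (\<chi> i j. case (i, j) of
    (Some a, Some b) \<Rightarrow> A $ a $ b | (None, None) \<Rightarrow> \<mu> | _ \<Rightarrow> 0)"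

lemma sum_option_UNIV:
  "(\<Sum>i\<in>(UNIV :: 'n::finite option set). f i) = f None + (\<Sum>a\<in>UNIV. f (Some a))"
  by (simp add: UNIV_option_conv sum.reindex o_def)

lemma augment_mult_vec:
  "augment A \<mu> *v x = (\<chi> i. case i of None \<Rightarrow> \<mu> * x $ None | Some a \<Rightarrow> (A *v (\<chi> b. x $ Some b)) $ a)"
  by (auto simp: vec_eq_iff augment_def matrix_vector_mult_def sum_option_UNIV split: option.split)

lemma symmetric_augment: "symmetric_mat A \<Longrightarrow> symmetric_mat (augment A \<mu>)"
  by (auto simp: symmetric_mat_def augment_def transpose_def vec_eq_iff split: option.splits)

section \<open>Spectrum of the bordered matrix and of its orthogonal conjugates\<close>

lemma subspace_eigenspace: "subspace (eigenspace A \<nu>)"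
  unfolding eigenspace_def by (rule subspaceI) (auto simp: algebra_simps)

text \<open>Padding with zero embeds each eigenspace of \<open>A\<close>; the last unit vector
  contributes one more dimension, and only to the eigenspace of \<mu>.\<close>

lemma multiplicity_of_augment:
  fixes A :: "real^'n^'n"
  shows
  "multiplicity_of (augment A \<mu>) \<nu> = multiplicity_of A \<nu> + (if \<nu> = \<mu> then 1 else 0)"
proof -
  define l where "l = (\<lambda>v :: real^'n. \<chi> i. case i of None \<Rightarrow> 0 | Some a \<Rightarrow> v $ a)"
  have linl: "linear l"
    by (auto intro!: linearI simp: l_def vec_eq_iff split: option.split)
  have inj: "inj l"
    by (rule injI) (auto simp: l_def vec_eq_iff split: option.splits)
  have diml: "dim (l ` S) = dim S" for S
    using dim_image_eq[OF linl, of S] inj by (auto intro: inj_on_subset)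
  have sub: "subspace (l ` eigenspace A \<nu>)"
    by (rule linear_subspace_image[OF linl subspace_eigenspace])
  have mem: "x \<in> eigenspace (augment A \<mu>) \<nu> \<longleftrightarrow>
      (\<chi> b. x $ Some b) \<in> eigenspace A \<nu> \<and> (\<nu> = \<mu> \<or> x $ None = 0)" for x
    unfolding eigenspace_def mem_Collect_eq augment_mult_vec
    by (auto simp: vec_eq_iff split: option.split dest: spec[of _ None] spec[of _ "Some _"])
  have l_iff: "x \<in> l ` eigenspace A \<nu> \<longleftrightarrow> (\<chi> b. x $ Some b) \<in> eigenspace A \<nu> \<and> x $ None = 0" for x
  proof
    assume "(\<chi> b. x $ Some b) \<in> eigenspace A \<nu> \<and> x $ None = 0"
    moreover from this have "x = l (\<chi> b. x $ Some b)"
      by (auto simp: l_def vec_eq_iff split: option.split)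
    ultimately show "x \<in> l ` eigenspace A \<nu>" by blast
  qed (auto simp: l_def)
  show ?thesis
  proof (cases "\<nu> = \<mu>")
    case False
    then have "eigenspace (augment A \<mu>) \<nu> = l ` eigenspace A \<nu>"
      using mem l_iff by auto
    then show ?thesis using False diml by (simp add: multiplicity_of_def)
  next
    case True
    let ?e = "axis None 1 :: real^'n option"
    have "eigenspace (augment A \<mu>) \<nu> = span (insert ?e (l ` eigenspace A \<nu>))"
    proof (rule set_eqI)
      fix x
      have "x \<in> span (insert ?e (l ` eigenspace A \<nu>)) \<longleftrightarrow> (\<exists>c. x - c *\<^sub>R ?e \<in> l ` eigenspace A \<nu>)"
        using sub by (simp add: span_insert span_eq_iff[THEN iffD2])
      also have "\<dots> \<longleftrightarrow> x \<in> eigenspace (augment A \<mu>) \<nu>"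
        unfolding l_iff mem using True by (auto simp: axis_def)
      finally show "x \<in> eigenspace (augment A \<mu>) \<nu> \<longleftrightarrow> x \<in> span (insert ?e (l ` eigenspace A \<nu>))"
        by simp
    qed
    moreover have "?e \<notin> span (l ` eigenspace A \<nu>)"
      using sub l_iff[of ?e] by (simp add: span_eq_iff[THEN iffD2] axis_def)
    ultimately show ?thesis
      using True diml by (simp add: multiplicity_of_def dim_insert)
  qed
qed

lemma multiplicity_of_orthogonal_conj:
  assumes "orthogonal_matrix U"
  shows "multiplicity_of (U ** A ** transpose U) \<nu> = multiplicity_of A \<nu>"
proof -
  have U: "transpose U ** U = mat 1" "U ** transpose U = mat 1"
    using assms by (auto simp: orthogonal_matrix_def)
  have U': "transpose U *v (U *v x) = x" "U *v (transpose U *v x) = x" for x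
    by (simp_all only: matrix_vector_mul_assoc U matrix_vector_mul_lid)
  have "eigenspace (U ** A ** transpose U) \<nu> = (*v) U ` eigenspace A \<nu>"
  proof (intro set_eqI iffI)
    fix x assume "x \<in> eigenspace (U ** A ** transpose U) \<nu>"
    then have "U *v (A *v (transpose U *v x)) = \<nu> *\<^sub>R x"
      by (simp add: eigenspace_def matrix_vector_mul_assoc matrix_mul_assoc
          del: transpose_matrix_vector)
    then have "A *v (transpose U *v x) = \<nu> *\<^sub>R (transpose U *v x)"
      by (metis U'(1) matrix_vector_mult_scaleR)
    then show "x \<in> (*v) U ` eigenspace A \<nu>"
      by (intro image_eqI[of _ _ "transpose U *v x"])
        (simp_all only: U' eigenspace_def mem_Collect_eq)
  next
    fix x assume "x \<in> (*v) U ` eigenspace A \<nu>"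
    then obtain y where y: "x = U *v y" "A *v y = \<nu> *\<^sub>R y" by (auto simp: eigenspace_def)
    have "(U ** A ** transpose U) *v x = U *v (A *v (transpose U *v (U *v y)))"
      by (simp only: matrix_vector_mul_assoc matrix_mul_assoc y)
    also have "\<dots> = \<nu> *\<^sub>R x" by (simp only: U' y matrix_vector_mult_scaleR)
    finally show "x \<in> eigenspace (U ** A ** transpose U) \<nu>" by (simp add: eigenspace_def)
  qed
  moreover have "inj ((*v) U)" by (metis U'(1) injI)
  ultimately show ?thesis
    unfolding multiplicity_of_def
    by (metis dim_image_eq inj_on_subset matrix_vector_mul_linear top_greatest)
qed

text \<open>Restriction to the coordinates in \<open>T\<close>, encoded by zeroing all others, is
  injective on \<open>V\<close> and lands in a space of the same dimension, hence is onto
  it.\<close>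

lemma subspace_interpolation:
  fixes V :: "(real^'m) set"
  assumes V: "subspace V" and dim: "dim V = card T"
    and inj: "\<And>x. x \<in> V \<Longrightarrow> (\<And>j. j \<in> T \<Longrightarrow> x $ j = 0) \<Longrightarrow> x = 0"
  obtains x where "x \<in> V" "\<And>j. j \<in> T \<Longrightarrow> x $ j = y j"
proof -
  define r where "r = (\<lambda>x :: real^'m. \<chi> j. if j \<in> T then x $ j else 0)"
  let ?W = "{x :: real^'m. \<forall>j. j \<notin> T \<longrightarrow> x $ j = 0}"
  have linr: "linear r" by (auto intro!: linearI simp: r_def vec_eq_iff)
  have "inj_on r V"
  proof (rule inj_onI)
    fix x z assume "x \<in> V" "z \<in> V" "r x = r z"
    then have "x - z = 0"
      using V by (intro inj subspace_diff) (auto simp: r_def vec_eq_iff split: if_splits)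
    then show "x = z" by simp
  qed
  then have "dim (r ` V) = card T"
    using dim_image_eq[OF linr, of V] V dim by (simp add: span_eq_iff[THEN iffD2])
  moreover have "subspace ?W" by (auto intro!: subspaceI)
  moreover have "subspace (r ` V)" by (rule linear_subspace_image[OF linr V])
  moreover have "r ` V \<subseteq> ?W" by (auto simp: r_def)
  ultimately have "r ` V = ?W"
    by (intro subspace_dim_equal) (auto simp: dim_substandard_cart dim_vec_eq[symmetric])
  then have "(\<chi> j. if j \<in> T then y j else 0) \<in> r ` V" by simp
  then obtain x where "x \<in> V" "r x = (\<chi> j. if j \<in> T then y j else 0)" by auto
  then show thesis
    by (intro that[of x]) (auto simp: r_def vec_eq_iff split: if_splits)
qed

section \<open>Graph and support conditions for the bordered matrix\<close>

lemma append_vertex_simps: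
  "{Some a, Some b} \<in> append_vertex E \<beta> \<longleftrightarrow> {a, b} \<in> E"
  "{Some a, None} \<in> append_vertex E \<beta> \<longleftrightarrow> a \<in> \<beta>"
  "{None, Some a} \<in> append_vertex E \<beta> \<longleftrightarrow> a \<in> \<beta>"
proof -
  have "{Some a, Some b} = Some ` e \<longleftrightarrow> {a, b} = e" for e
    using inj_image_eq_iff[OF inj_Some, of "{a, b}" e] by simp
  then have "{Some a, Some b} \<in> (`) Some ` E \<longleftrightarrow> {a, b} \<in> E"
    by (simp only: image_iff) simp
  then show "{Some a, Some b} \<in> append_vertex E \<beta> \<longleftrightarrow> {a, b} \<in> E"
    unfolding append_vertex_def by (simp add: doubleton_eq_iff)
  have "{Some a, None} \<noteq> Some ` e" for e by blast
  then have "{Some a, None} \<notin> (`) Some ` E" by blast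
  then show "{Some a, None} \<in> append_vertex E \<beta> \<longleftrightarrow> a \<in> \<beta>"
    unfolding append_vertex_def by (simp add: doubleton_eq_iff)
  then show "{None, Some a} \<in> append_vertex E \<beta> \<longleftrightarrow> a \<in> \<beta>"
    by (simp add: insert_commute)
qed

text \<open>The old coordinates of a nonzero \<open>x\<close> would form an eigenvector of
  \<open>A\<close> whose support meets \<alpha> at most in \<open>i\<close>. Phrased as a trivial
  kernel on a subspace, the condition survives small perturbations.\<close>

lemma augment_eigen_injective:
  fixes A :: "real^'n^'n"
  assumes "\<And>x. eigenvector A \<mu> x \<Longrightarrow> card (supp x \<inter> \<alpha>) \<ge> 2"
    and "(augment A \<mu> - \<mu> *\<^sub>R mat 1) *v x = 0" "x $ None = 0"
    and "\<And>j. j \<in> \<alpha> - {i} \<Longrightarrow> x $ Some j = 0"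
  shows "x = 0"
proof -
  let ?y = "\<chi> b. x $ Some b"
  have "augment A \<mu> *v x = \<mu> *\<^sub>R x"
    using assms(2) by (simp add: matrix_vector_mult_diff_rdistrib scaleR_matrix_vector_assoc[symmetric])
  then have "A *v ?y = \<mu> *\<^sub>R ?y"
    unfolding augment_mult_vec by (auto simp: vec_eq_iff dest: spec[of _ "Some _"])
  moreover have "card (supp ?y \<inter> \<alpha>) \<le> card {i}"
    using assms(4) by (intro card_mono) (auto simp: supp_def)
  ultimately have "?y = 0"
    using assms(1)[of ?y] by (force simp: eigenvector_def)
  then have "x $ j = 0" for j
    using assms(3) by (cases j) (auto simp: vec_eq_iff)
  then show ?thesis by (simp add: vec_eq_iff)
qed

text \<open>The entry of \<open>X\<close> joining \<open>c\<close> to the new vertex is left free.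
  The support bound 2, rather than 1, is what pays for this freedom.\<close>

lemma augment_commutator_eq_0:
  fixes A :: "real^'n^'n"
  assumes A: "A \<in> graph_matrices E" "SSP A"
    and eig: "\<And>x. eigenvector A \<mu> x \<Longrightarrow> card (supp x \<inter> \<alpha>) \<ge> 2"
    and X: "symmetric_mat X"
      "\<And>i j. i = j \<or> {i, j} \<in> append_vertex E (\<alpha> - {c}) \<Longrightarrow> X $ i $ j = 0"
    and comm: "commutator (augment A \<mu>) X = 0"
  shows "X = 0"
proof -
  define X1 where "X1 = (\<chi> a b. X $ Some a $ Some b)"
  define y where "y = (\<chi> a. X $ Some a $ None)"
  have comm': "(augment A \<mu> ** X) $ i $ j = (X ** augment A \<mu>) $ i $ j" for i j
    using comm by (simp add: commutator_def vec_eq_iff)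
  have "(A ** X1) $ a $ b = (X1 ** A) $ a $ b" for a b
    using comm'[of "Some a" "Some b"]
    by (simp add: X1_def matrix_matrix_mult_def sum_option_UNIV augment_def)
  then have "commutator A X1 = 0" by (simp add: commutator_def vec_eq_iff)
  moreover have "symmetric_mat X1"
    using X(1) by (simp add: symmetric_mat_def transpose_def X1_def vec_eq_iff)
  moreover have "A $ a $ b * X1 $ a $ b = 0" "mat 1 $ a $ b * X1 $ a $ b = 0" for a b
    using A(1) X(2)[of "Some a" "Some b"]
    by (cases "a = b"; force simp: X1_def graph_matrices_def append_vertex_simps mat_def)+
  then have "entrywise_prod A X1 = 0" "entrywise_prod (mat 1) X1 = 0"
    by (simp_all add: entrywise_prod_def vec_eq_iff)
  ultimately have X1: "X1 = 0" using A(2) unfolding SSP_def by blast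
  \<comment> \<open>In the last column of the commutator, \<open>X\<close> meets only the diagonal
    entry \<mu> of the border.\<close>
  have "(A *v y) $ a = \<mu> * y $ a" for a
    using comm'[of "Some a" None]
    by (simp add: y_def matrix_matrix_mult_def matrix_vector_mult_def sum_option_UNIV augment_def)
  then have "A *v y = \<mu> *\<^sub>R y" by (simp add: vec_eq_iff)
  moreover have "y $ v = 0" if "v \<in> \<alpha> - {c}" for v
    using that X(2)[of "Some v" None] by (simp add: y_def append_vertex_simps)
  then have "card (supp y \<inter> \<alpha>) \<le> card {c}"
    by (intro card_mono) (auto simp: supp_def)
  ultimately have y: "y = 0"
    using eig[of y] by (force simp: eigenvector_def)
  have "X $ i $ j = 0" for i j
  proof (cases i; cases j)
    fix a b assume "i = Some a" "j = Some b"
    then show ?thesis using arg_cong[OF X1, of "\<lambda>X. X $ a $ b"] by (simp add: X1_def)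
  next
    fix a assume "i = Some a" "j = None"
    then show ?thesis using arg_cong[OF y, of "\<lambda>y. y $ a"] by (simp add: y_def)
  next
    fix a assume "i = None" "j = Some a"
    then show ?thesis
      using arg_cong[OF y, of "\<lambda>y. y $ a"] symmetric_matD[OF X(1), of i j] by (simp add: y_def)
  qed (use X(2) in simp)
  then show ?thesis by (simp add: vec_eq_iff)
qed

text \<open>If the entry at \<open>i\<close> vanished, interpolation would give a vector of the
  eigenspace agreeing with the border row on the rest of \<alpha>; row \<open>None\<close> of the
  eigenvalue equation then equates the sum of squared border entries to zero.\<close>

lemma border_nonzero:
  fixes C :: "real^('n::finite) option^'n option"
  assumes card: "card \<alpha> = k + 1" and i: "i \<in> \<alpha>"
    and mult: "multiplicity_of C \<mu> = k + 1"
    and inj: "\<And>x. (C - \<mu> *\<^sub>R mat 1) *v x = 0 \<Longrightarrow> x $ None = 0 \<Longrightarrow>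
      (\<And>j. j \<in> \<alpha> - {i} \<Longrightarrow> x $ Some j = 0) \<Longrightarrow> x = 0"
    and supp: "\<And>a. a \<notin> \<alpha> \<Longrightarrow> C $ None $ Some a = 0"
    and nz: "C $ None $ Some i0 \<noteq> 0"
  shows "C $ None $ Some i \<noteq> 0"
proof
  assume 0: "C $ None $ Some i = 0"
  let ?V = "eigenspace C \<mu>" and ?T = "insert None (Some ` (\<alpha> - {i}))"
  \<comment> \<open>Dropping \<open>i\<close> leaves \<open>k\<close> indices and
    \<open>None\<close> restores the count to the dimension of the eigenspace.\<close>
  have "card ?T = k + 1"
    using card i by (subst card_insert_disjoint) (auto simp: card_image)
  then have dim: "dim ?V = card ?T" using mult by (simp add: multiplicity_of_def)
  have kerV: "(C - \<mu> *\<^sub>R mat 1) *v x = 0 \<longleftrightarrow> x \<in> ?V" for x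
    by (simp add: eigenspace_def matrix_vector_mult_diff_rdistrib scaleR_matrix_vector_assoc[symmetric])
  obtain x where x: "x \<in> ?V"
      "\<And>j. j \<in> ?T \<Longrightarrow> x $ j = (case j of None \<Rightarrow> 0 | Some a \<Rightarrow> C $ None $ Some a)"
    by (rule subspace_interpolation[OF subspace_eigenspace dim,
        where y = "\<lambda>j. case j of None \<Rightarrow> 0 | Some a \<Rightarrow> C $ None $ Some a"]) (use inj kerV in auto)
  \<comment> \<open>The coordinates of \<open>x\<close> at \<open>i\<close> and outside \<alpha> are
    unknown, but they are multiplied by zero border entries.\<close>
  have "(\<Sum>a\<in>UNIV. (C $ None $ Some a)\<^sup>2) = (\<Sum>a\<in>UNIV. C $ None $ Some a * x $ Some a)"
  proof (rule sum.cong)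
    fix a
    show "(C $ None $ Some a)\<^sup>2 = C $ None $ Some a * x $ Some a"
      using 0 supp[of a] x(2)[of "Some a"]
      by (cases "a \<in> \<alpha> - {i}") (auto simp: power2_eq_square)
  qed simp
  \<comment> \<open>The choice \<open>x $ None = 0\<close> removes the uncontrolled diagonal entry
    of \<open>C\<close>, and next the right-hand side \<open>\<mu> * x $ None\<close>.\<close>
  also have "\<dots> = (C *v x) $ None"
    using x(2)[of None] by (simp add: matrix_vector_mult_def sum_option_UNIV)
  also have "\<dots> = 0" using x by (simp add: eigenspace_def)
  finally have "C $ None $ Some i0 = 0" by (simp add: sum_nonneg_eq_0_iff)
  then show False using nz by simp
qed

section \<open>Construction of the enlarged matrix\<close>

theorem lemma7p5:
  fixes E :: "'n::finite set set"
    and A :: "real^'n^'n"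
    and \<mu> :: real
    and k :: nat
    and \<alpha> :: "'n set"
  assumes "simple_graph E"
    and "A \<in> graph_matrices E"
    and "SSP A"
    and "multiplicity_of A \<mu> = k"
    and "k \<ge> 1"
    and "card \<alpha> = k + 1"
    and "\<And>x. eigenvector A \<mu> x \<Longrightarrow> card (supp x \<inter> \<alpha>) \<ge> 2"
  shows "\<exists>A' \<in> graph_matrices (append_vertex E \<alpha>).
           SSP A' \<and>
           multiplicity_of A' \<mu> = k + 1 \<and>
           (\<forall>\<nu>. \<nu> \<noteq> \<mu> \<longrightarrow> multiplicity_of A' \<nu> = multiplicity_of A \<nu>)"
proof -
  have symA: "symmetric_mat A" using assms(2) by (simp add: graph_matrices_def)
  obtain i0 where i0: "i0 \<in> \<alpha>" using assms(6) by (metis Suc_eq_plus1 card.empty equals0I nat.distinct(1))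
  define B where "B = augment A \<mu>"
  have symB: "symmetric_mat B" unfolding B_def by (rule symmetric_augment[OF symA])
  \<comment> \<open>The entries to prescribe: nonedges of the enlarged graph together with the pair
    of \<open>i0\<close> and \<open>None\<close>. The diagonal and the remaining edges stay
    free.\<close>
  define Z where "Z = (\<lambda>i j. i \<noteq> j \<and> {i, j} \<notin> append_vertex E (\<alpha> - {i0}))"
  have "symp Z" by (auto simp: Z_def insert_commute intro!: sympI)
  define \<X> where "\<X> = {X :: real^'n option^'n option. symmetric_mat X \<and> (\<forall>i j. \<not> Z i j \<longrightarrow> X $ i $ j = 0)}"
  have sub\<X>: "subspace \<X>"
    by (auto intro!: subspaceI simp: \<X>_def symmetric_mat_def transpose_simps transpose_0)
  have trans: "X = 0" if "X \<in> \<X>" "commutator B X = 0" for X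
    by (rule augment_commutator_eq_0[OF assms(2,3,7), where c = i0])
      (use that in \<open>auto simp: \<X>_def Z_def B_def\<close>)
  define S where "S = (\<lambda>i. {x :: real^'n option. x $ None = 0 \<and> (\<forall>j\<in>\<alpha> - {i}. x $ Some j = 0)})"
  have subS: "subspace (S i)" for i
    by (rule subspaceI) (simp_all add: S_def)
  \<comment> \<open>Three open conditions at \<open>B\<close>: transversality for the SSP,
    injectivity for \<open>border_nonzero\<close>, and survival of the nonzero entries for the old
    edges.\<close>
  define P where "P = (\<lambda>C. (\<forall>X\<in>\<X>. commutator C X = 0 \<longrightarrow> X = 0) \<and>
    (\<forall>i. \<forall>x\<in>S i. (C - \<mu> *\<^sub>R mat 1) *v x = 0 \<longrightarrow> x = 0) \<and>
    (\<forall>i j. B $ i $ j \<noteq> 0 \<longrightarrow> C $ i $ j \<noteq> 0))"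
  have "\<forall>\<^sub>F C in nhds B. \<forall>X\<in>\<X>. commutator C X = 0 \<longrightarrow> X = 0"
    by (rule eventually_injective_on[OF bounded_bilinear_commutator sub\<X> trans])
  moreover have "\<forall>\<^sub>F C in nhds B. \<forall>i. \<forall>x\<in>S i. (C - \<mu> *\<^sub>R mat 1) *v x = 0 \<longrightarrow> x = 0"
  proof (rule eventually_all_finite)
    fix i
    have "\<forall>\<^sub>F C in nhds (B - \<mu> *\<^sub>R mat 1). \<forall>x\<in>S i. C *v x = 0 \<longrightarrow> x = 0"
    proof (rule eventually_injective_on[OF bounded_bilinear_matrix_vector_mult subS])
      fix x assume "x \<in> S i" "(B - \<mu> *\<^sub>R mat 1) *v x = 0"
      then show "x = 0"
        using augment_eigen_injective[of A \<mu> \<alpha> x i] assms(7) by (simp add: S_def B_def)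
    qed
    moreover have "((\<lambda>C. C - \<mu> *\<^sub>R mat 1) \<longlongrightarrow> B - \<mu> *\<^sub>R mat 1) (nhds B)"
      by (intro tendsto_intros filterlim_ident)
    ultimately show "\<forall>\<^sub>F C in nhds B. \<forall>x\<in>S i. (C - \<mu> *\<^sub>R mat 1) *v x = 0 \<longrightarrow> x = 0"
      by (rule eventually_compose_filterlim)
  qed
  moreover have "\<forall>\<^sub>F C in nhds B. \<forall>i j. B $ i $ j \<noteq> 0 \<longrightarrow> C $ i $ j \<noteq> 0"
  proof (intro eventually_all_finite)
    fix i j
    have "((\<lambda>C. C $ i $ j) \<longlongrightarrow> B $ i $ j) (nhds B)"
      by (intro tendsto_intros filterlim_ident)
    then show "\<forall>\<^sub>F C in nhds B. B $ i $ j \<noteq> 0 \<longrightarrow> C $ i $ j \<noteq> 0"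
      by (cases "B $ i $ j = 0") (auto dest: tendsto_imp_eventually_ne)
  qed
  ultimately have "eventually P (nhds B)"
    unfolding P_def by (intro eventually_conj)
  note ev = isospectral_perturbation[OF symB \<open>symp Z\<close> _ this]
  \<comment> \<open>Only the entries of \<open>Y t\<close> on \<open>Z\<close> are used.
    \<open>B\<close> vanishes there, so the target is zero except for \<open>t\<close> between
    \<open>i0\<close> and \<open>None\<close>; \<open>Y t\<close> itself need not be isospectral to
    \<open>B\<close>.\<close>
  define D :: "real^'n option^'n option"
    where "D = (\<chi> i j. if {i, j} = {Some i0, None} then 1 else 0)"
  define Y where "Y = (\<lambda>t. B + t *\<^sub>R D)"
  have "(Y \<longlongrightarrow> B + 0 *\<^sub>R D) (at_right 0)"
    unfolding Y_def by (intro tendsto_intros)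
  then have "(Y \<longlongrightarrow> B) (at_right 0)" by simp
  then have "\<forall>\<^sub>F t in at_right 0. symmetric_mat (Y t) \<longrightarrow>
    (\<exists>U. orthogonal_matrix U \<and> P (U ** B ** transpose U) \<and>
      (\<forall>i j. Z i j \<longrightarrow> (U ** B ** transpose U) $ i $ j = Y t $ i $ j))"
    by (intro eventually_compose_filterlim[OF ev]) (use trans in \<open>auto simp: \<X>_def\<close>)
  moreover have "\<forall>\<^sub>F t in at_right 0. t > (0 :: real)" by (rule eventually_at_right_less)
  ultimately have "\<forall>\<^sub>F t in at_right 0. t > 0 \<and> (symmetric_mat (Y t) \<longrightarrow>
    (\<exists>U. orthogonal_matrix U \<and> P (U ** B ** transpose U) \<and>
      (\<forall>i j. Z i j \<longrightarrow> (U ** B ** transpose U) $ i $ j = Y t $ i $ j)))"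
    by eventually_elim auto
  then obtain t where t: "t > 0" "symmetric_mat (Y t) \<longrightarrow>
    (\<exists>U. orthogonal_matrix U \<and> P (U ** B ** transpose U) \<and>
      (\<forall>i j. Z i j \<longrightarrow> (U ** B ** transpose U) $ i $ j = Y t $ i $ j))"
    using eventually_happens[of _ "at_right (0 :: real)"] trivial_limit_at_right_real by blast
  have "symmetric_mat (Y t)"
    using symB
    by (simp add: symmetric_mat_def transpose_simps Y_def)
      (simp add: D_def transpose_def vec_eq_iff insert_commute)
  then obtain U where U: "orthogonal_matrix U" "P (U ** B ** transpose U)"
      "\<And>i j. Z i j \<Longrightarrow> (U ** B ** transpose U) $ i $ j = Y t $ i $ j"
    using t(2) by blast
  define C where "C = U ** B ** transpose U"
  have symC: "symmetric_mat C"
    using symB by (simp add: C_def symmetric_mat_def matrix_transpose_mul matrix_mul_assoc)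
  have PC: "P C" using U(2) by (simp add: C_def)
  have ZC: "C $ i $ j = Y t $ i $ j" if "Z i j" for i j using U(3)[OF that] by (simp add: C_def)
  have mult: "multiplicity_of C \<nu> = multiplicity_of A \<nu> + (if \<nu> = \<mu> then 1 else 0)" for \<nu>
    unfolding C_def B_def by (simp add: multiplicity_of_orthogonal_conj[OF U(1)] multiplicity_of_augment)
  have border_out: "C $ None $ Some a = 0" if "a \<notin> \<alpha>" for a
    using that i0 ZC[of None "Some a"]
    by (auto simp: Z_def append_vertex_simps Y_def D_def B_def augment_def doubleton_eq_iff)
  have border_i0: "C $ None $ Some i0 \<noteq> 0"
    using t(1) ZC[of None "Some i0"]
    by (auto simp: Z_def append_vertex_simps Y_def D_def B_def augment_def doubleton_eq_iff)
  have border_in: "C $ None $ Some a \<noteq> 0" if "a \<in> \<alpha>" for a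
  proof (rule border_nonzero[OF assms(6) that _ _ border_out border_i0])
    show "multiplicity_of C \<mu> = k + 1" using assms(4) by (simp add: mult)
    fix x assume "(C - \<mu> *\<^sub>R mat 1) *v x = 0" "x $ None = 0"
      "\<And>j. j \<in> \<alpha> - {a} \<Longrightarrow> x $ Some j = 0"
    moreover from this have "x \<in> S a" by (simp add: S_def)
    ultimately show "x = 0" using PC unfolding P_def by blast
  qed
  \<comment> \<open>Old edges keep nonzero entries by openness, while old nonedges lie in
    \<open>Z\<close> and keep the value zero exactly.\<close>
  have inner: "C $ Some a $ Some b \<noteq> 0 \<longleftrightarrow> {a, b} \<in> E" if "a \<noteq> b" for a b
  proof (cases "{a, b} \<in> E")
    case True
    then have "B $ Some a $ Some b \<noteq> 0"
      using assms(2) that by (simp add: graph_matrices_def B_def augment_def)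
    then show ?thesis using PC True by (simp add: P_def)
  next
    case False
    then have "C $ Some a $ Some b = A $ a $ b"
      using ZC[of "Some a" "Some b"] that
      by (simp add: Z_def append_vertex_simps Y_def D_def B_def augment_def doubleton_eq_iff)
    then show ?thesis using assms(2) that by (simp add: graph_matrices_def)
  qed
  have "C $ i $ j \<noteq> 0 \<longleftrightarrow> {i, j} \<in> append_vertex E \<alpha>" if "i \<noteq> j" for i j
    using that inner border_in border_out symmetric_matD[OF symC]
    by (cases i; cases j) (auto simp: append_vertex_simps)
  then have graphC: "C \<in> graph_matrices (append_vertex E \<alpha>)"
    using symC by (simp add: graph_matrices_def)
  \<comment> \<open>Positions outside \<open>Z\<close> are diagonal or edges of the enlarged graph,
    where \<open>C\<close> is nonzero. Hence every matrix tested by the SSP of \<open>C\<close> is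
    supported on \<open>Z\<close>, where transversality applies.\<close>
  have "append_vertex E (\<alpha> - {i0}) \<subseteq> append_vertex E \<alpha>"
    by (auto simp: append_vertex_def)
  then have ne: "C $ i $ j \<noteq> 0" if "i \<noteq> j" "\<not> Z i j" for i j
    using that graphC by (auto simp: graph_matrices_def Z_def)
  have "SSP C"
    unfolding SSP_def
  proof (intro allI impI, elim conjE)
    fix X assume X: "symmetric_mat X" "entrywise_prod C X = 0" "entrywise_prod (mat 1) X = 0"
      "commutator C X = 0"
    have "X $ i $ j = 0" if "\<not> Z i j" for i j
      using that ne[of i j] arg_cong[OF X(2), of "\<lambda>M. M $ i $ j"]
        arg_cong[OF X(3), of "\<lambda>M. M $ i $ j"]
      by (cases "i = j") (auto simp: entrywise_prod_def mat_def)
    then have "X \<in> \<X>" using X(1) by (simp add: \<X>_def)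
    then show "X = 0" using PC X(4) by (simp add: P_def)
  qed
  then show ?thesis using graphC mult assms(4) by (intro bexI[of _ C]) auto
qed

end
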